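(* Assume $c < 1/18$. For any (possibly adaptive) algorithm $A$, if $A$ uses $c \sum_{i:\, i> k} \frac{\theta_i}{\theta_k}$ comparisons of any size (sets of any size between $2$ and $n$), then $A$ identifies the top-$k$ items with probability at most $7/8$. This holds even if $A$ is given the values $\{\theta_1,\dots,\theta_n\}$.
   Context: MNL model: $n$ items with positive scores $\theta_1\ge\cdots\ge\theta_k>\theta_{k+1}\ge\cdots\ge\theta_n$; the top-$k$ items are those with scores $\theta_1,\dots,\theta_k$. The algorithm sees the items only via labels given by a uniformly random permutation $\pi$ of $[n]$ (item with score $\theta_i$ has label $\pi_i$); it may know the multiset of score values but not which label carries which score. In each round it chooses (adaptively) a set $S$ of at least two items and observes one item $a\in S$ with probability $\theta_a/\sum_{j\in S}\theta_j$, independently of the past given $S$. Each round is one comparison. Success means outputting $\{\pi_1,\dots,\pi_k\}$; probability is over $\pi$, outcomes and the algorithm's randomness. *)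

theory Defs
  imports "HOL-Probability.Probability" "HOL-Combinatorics.Permutations"
begin

definition mnl_pmf :: "(nat \<Rightarrow> real) \<Rightarrow> nat set \<Rightarrow> nat pmf" where
  "mnl_pmf w S = embed_pmf (\<lambda>a. if a \<in> S then w a / (\<Sum>j\<in>S. w j) else 0)"

lemma pmf_mnl_pmf:
  assumes "finite S" "S \<noteq> {}" "\<And>a. a \<in> S \<Longrightarrow> 0 < w a"
  shows "pmf (mnl_pmf w S) a = (if a \<in> S then w a / (\<Sum>j\<in>S. w j) else 0)"
proof -
  define f where "f = (\<lambda>a. if a \<in> S then w a / (\<Sum>j\<in>S. w j) else 0)"
  have pos: "0 < (\<Sum>j\<in>S. w j)"
    using assms by (intro sum_pos) auto
  have nn: "0 \<le> f x" for x
    unfolding f_def using assms(3)[of x] pos by (simp add: less_imp_le)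
  have "(\<Sum>x\<in>S. f x) = (\<Sum>x\<in>S. w x / (\<Sum>j\<in>S. w j))"
    unfolding f_def by (intro sum.cong) simp_all
  also have "\<dots> = (\<Sum>x\<in>S. w x) / (\<Sum>j\<in>S. w j)"
    by (rule sum_divide_distrib[symmetric])
  also have "\<dots> = 1"
    using pos by simp
  finally have sum1: "(\<Sum>x\<in>S. f x) = 1" .
  have "(\<integral>\<^sup>+x. ennreal (f x) \<partial>count_space UNIV) = (\<Sum>x\<in>S. ennreal (f x))"
    by (rule nn_integral_count_space') (simp_all add: assms(1) f_def)
  also have "\<dots> = ennreal (\<Sum>x\<in>S. f x)"
    by (rule sum_ennreal) (rule nn)
  finally have "(\<integral>\<^sup>+x. ennreal (f x) \<partial>count_space UNIV) = 1"
    by (simp add: sum1)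
  then have "pmf (embed_pmf f) a = f a"
    by (intro pmf_embed_pmf nn)
  then show ?thesis
    by (simp add: mnl_pmf_def f_def)
qed

datatype action = Compare "nat set" | Output "nat set"

text \<open>The sets compared so far with the item observed for each, oldest first.\<close>

type_synonym history = "(nat set \<times> nat) list"

text \<open>
  A deterministic adaptive algorithm is a function from histories to actions. The number
  argument of \<open>play\<close> is the number of comparisons still allowed. For an algorithm that satisfies
  \<open>admissible\<close> below with the same allowance, the \<open>Compare\<close> branch of the first equation is
  never taken.
\<close>

primrec play ::
    "(nat \<Rightarrow> real) \<Rightarrow> (history \<Rightarrow> action) \<Rightarrow> nat \<Rightarrow> history \<Rightarrow> nat set pmf" where
  "play w alg 0 h = return_pmf (case alg h of Output X \<Rightarrow> X | Compare S \<Rightarrow> {})"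
| "play w alg (Suc t) h =
    (case alg h of
       Output X \<Rightarrow> return_pmf X
     | Compare S \<Rightarrow> bind_pmf (mnl_pmf w S) (\<lambda>a. play w alg t (h @ [(S, a)])))"

definition admissible :: "nat \<Rightarrow> nat \<Rightarrow> (history \<Rightarrow> action) \<Rightarrow> bool" where
  "admissible n T alg \<longleftrightarrow>
    (\<forall>h S. alg h = Compare S \<longrightarrow> S \<subseteq> {1..n} \<and> 2 \<le> card S \<and> length h < T)"

text \<open>
  Joint law of the labelling and the output. The item with score \<open>\<theta> i\<close> carries the label \<open>\<pi> i\<close>,
  so the score of label \<open>a\<close> is \<open>\<theta> (inv \<pi> a)\<close>.
\<close>

definition trial ::
    "nat \<Rightarrow> (nat \<Rightarrow> real) \<Rightarrow> nat \<Rightarrow> (history \<Rightarrow> action) \<Rightarrow> ((nat \<Rightarrow> nat) \<times> nat set) pmf" where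
  "trial n \<theta> T alg =
    bind_pmf (pmf_of_set {\<pi>. \<pi> permutes {1..n}}) (\<lambda>\<pi>.
      map_pmf (\<lambda>X. (\<pi>, X)) (play (\<lambda>a. \<theta> (inv \<pi> a)) alg T []))"

text \<open>
  A randomized algorithm is a family \<open>A\<close> of deterministic ones, indexed by a seed drawn from an
  arbitrary probability space \<open>M\<close>, independently of the labelling and of the comparison noise.
  Measurability means that each decision is a random variable.
\<close>

definition randomized_algorithm ::
    "nat \<Rightarrow> nat \<Rightarrow> 'r measure \<Rightarrow> ('r \<Rightarrow> history \<Rightarrow> action) \<Rightarrow> bool" where
  "randomized_algorithm n T M A \<longleftrightarrow>
    prob_space M \<and>
    (\<forall>h. (\<lambda>r. A r h) \<in> measurable M (count_space UNIV)) \<and>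
    (\<forall>r\<in>space M. admissible n T (A r))"

text \<open>The integrand of \<open>success_prob\<close> below is measurable, so that integral is a true expectation.\<close>

lemma prob_bind_pmf:
  "measure_pmf.prob (bind_pmf p f) E = (\<integral>x. measure_pmf.prob (f x) E \<partial>measure_pmf p)"
  unfolding measure_pmf_bind
  by (rule measure_pmf.measure_bind[where N = "count_space UNIV"])
    (simp_all add: measure_pmf_in_subprob_algebra)

lemma measurable_integral_pmf:
  fixes f :: "'a \<Rightarrow> 'b::countable \<Rightarrow> real"
  assumes "\<And>a. (\<lambda>r. f r a) \<in> borel_measurable M"
  shows "(\<lambda>r. \<integral>a. f r a \<partial>measure_pmf p) \<in> borel_measurable M"
proof (rule measure_pmf.borel_measurable_lebesgue_integral)
  have "(\<lambda>(a, r). f r a) \<in> borel_measurable (count_space UNIV \<Otimes>\<^sub>M M)"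
    by (rule measurable_pair_measure_countable1) (simp_all add: assms)
  then have "(\<lambda>(r, a). f r a) \<in> borel_measurable (M \<Otimes>\<^sub>M count_space UNIV)"
    by (subst measurable_pair_swap_iff) (simp add: split_beta')
  moreover have "sets (M \<Otimes>\<^sub>M measure_pmf p) = sets (M \<Otimes>\<^sub>M count_space UNIV)"
    by (rule sets_pair_measure_cong) simp_all
  ultimately show "(\<lambda>(r, a). f r a) \<in> borel_measurable (M \<Otimes>\<^sub>M measure_pmf p)"
    by (simp cong: measurable_cong_sets)
qed

lemma measurable_play:
  assumes "randomized_algorithm n T M A"
  shows "(\<lambda>r. measure_pmf.prob (play w (A r) t h) E) \<in> borel_measurable M"
proof (induction t arbitrary: h)
  case 0
  have A: "(\<lambda>r. A r h) \<in> measurable M (count_space UNIV)"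
    using assms unfolding randomized_algorithm_def by blast
  have "(\<lambda>x. measure_pmf.prob (return_pmf (case x of Output X \<Rightarrow> X | Compare S \<Rightarrow> {})) E)
      \<in> borel_measurable (count_space UNIV)"
    by (rule borel_measurable_count_space)
  from measurable_compose[OF A this] show ?case
    by (simp only: play.simps)
next
  case (Suc t)
  have A: "(\<lambda>r. A r h) \<in> measurable M (count_space UNIV)"
    and adm: "\<And>r. r \<in> space M \<Longrightarrow> admissible n T (A r)"
    using assms unfolding randomized_algorithm_def by blast+
  define g where
    "g S r = (\<integral>a. measure_pmf.prob (play w (A r) t (h @ [(S, a)])) E \<partial>measure_pmf (mnl_pmf w S))"
    for S r
  have g: "g S \<in> borel_measurable M" for S
    unfolding g_def by (rule measurable_integral_pmf) (rule Suc.IH)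
  define out :: "action \<Rightarrow> real" where
    "out x = (case x of Output X \<Rightarrow> indicator E X | Compare S \<Rightarrow> 0)" for x
  have "measure_pmf.prob (play w (A r) (Suc t) h) E =
      (\<Sum>S\<in>Pow {1..n}. indicator {Compare S} (A r h) * g S r) + out (A r h)"
    if r: "r \<in> space M" for r
  proof (cases "A r h")
    case (Output X)
    then show ?thesis by (simp add: out_def measure_return_pmf)
  next
    case (Compare S)
    have S: "S \<in> Pow {1..n}"
      using adm[OF r] Compare unfolding admissible_def by blast
    have "(\<Sum>S'\<in>Pow {1..n}. indicator {Compare S'} (A r h) * g S' r)
        = (\<Sum>S'\<in>Pow {1..n}. if S = S' then g S' r else 0)"
      by (rule sum.cong) (auto simp: Compare)
    also have "\<dots> = g S r"
      using S by (simp add: sum.delta')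
    finally show ?thesis
      by (simp add: Compare out_def g_def prob_bind_pmf)
  qed
  then have "?case \<longleftrightarrow> (\<lambda>r. (\<Sum>S\<in>Pow {1..n}. indicator {Compare S} (A r h) * g S r) + out (A r h))
      \<in> borel_measurable M"
    by (rule measurable_cong)
  moreover have "(\<lambda>r. (\<Sum>S\<in>Pow {1..n}. indicator {Compare S} (A r h) * g S r) + out (A r h))
      \<in> borel_measurable M"
    by (intro borel_measurable_add borel_measurable_sum borel_measurable_times g
          measurable_compose[OF A borel_measurable_count_space])
  ultimately show ?case by blast
qed

lemma measurable_trial:
  assumes "randomized_algorithm n T M A"
  shows "(\<lambda>r. measure_pmf.prob (trial n \<theta> T (A r)) E) \<in> borel_measurable M"
proof -
  have fin: "finite {\<pi>. \<pi> permutes {1..n}}" "{\<pi>. \<pi> permutes {1..n}} \<noteq> {}"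
    using finite_permutations[of "{1..n}"] permutes_id[of "{1..n}"] by blast+
  show ?thesis
    unfolding trial_def prob_bind_pmf integral_pmf_of_set[OF fin(2,1)] measure_map_pmf
    by (intro borel_measurable_divide borel_measurable_sum borel_measurable_const
          measurable_play[OF assms])
qed

definition success_prob ::
    "nat \<Rightarrow> nat \<Rightarrow> (nat \<Rightarrow> real) \<Rightarrow> nat \<Rightarrow> 'r measure \<Rightarrow> ('r \<Rightarrow> history \<Rightarrow> action) \<Rightarrow> real" where
  "success_prob n k \<theta> T M A =
    (\<integral>r. measure_pmf.prob (trial n \<theta> T (A r)) {(\<pi>, X). X = \<pi> ` {1..k}} \<partial>M)"

end

theory Submission imports Defs begin

text \<open>
  Exchanging the ranks \<open>k\<close> and \<open>j > k\<close> preserves the uniform labelling but changes the correct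
  answer, so the success probability is at most \<open>1/2\<close> plus half the mean total variation distance
  between the histories under \<open>\<pi>\<close> and under the exchanged labelling. Run both plays in a maximal
  coupling. Writing \<open>a, b\<close> for the labels of \<open>k, j\<close> and \<open>w, w'\<close> for the two weightings, a comparison
  of \<open>S\<close> breaks the coupling with probability at most \<open>\<theta> k * ([b \<in> S] / w S + [a \<in> S] / w' S)\<close>.
  The coupled part of the law lies below both laws, so the first term may be charged to the play under
  \<open>w\<close> and the second to the play under \<open>w'\<close>; in each of them the charged label has the score \<open>\<theta> j\<close>.
  Averaging over \<open>j\<close> with weights proportional to \<open>\<theta> j\<close> therefore makes every comparison cost at most
  \<open>2 * \<theta> k / (\<Sum>j>k. \<theta> j)\<close>, which gives a success probability of at most \<open>1/2 + c\<close>.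
\<close>

section \<open>Expected cost of a play\<close>

text \<open>For positive weights this is the expected sum of \<open>g S\<close> over the comparisons
  made. The recursion runs parallel to \<open>play\<close>, so no law on histories has to be built
  and inductions can unfold both at once.\<close>

primrec play_cost ::
    "(nat \<Rightarrow> real) \<Rightarrow> (nat set \<Rightarrow> real) \<Rightarrow> (history \<Rightarrow> action) \<Rightarrow> nat \<Rightarrow> history \<Rightarrow> real" where
  "play_cost w g alg 0 h = 0"
| "play_cost w g alg (Suc t) h =
    (case alg h of
       Output X \<Rightarrow> 0
     | Compare S \<Rightarrow> g S + (\<Sum>x\<in>S. w x / sum w S * play_cost w g alg t (h @ [(S, x)])))"

lemma admissible_CompareD:
  assumes "admissible n T alg" "alg h = Compare S"
  shows "S \<subseteq> {1..n}" "S \<noteq> {}"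
proof -
  have "S \<subseteq> {1..n} \<and> 2 \<le> card S"
    using assms unfolding admissible_def by blast
  then show "S \<subseteq> {1..n}" "S \<noteq> {}" by auto
qed

lemma play_cost_nonneg:
  assumes "admissible n T alg" and "\<And>i. i \<in> {1..n} \<Longrightarrow> 0 < w i"
    and "\<And>S. S \<subseteq> {1..n} \<Longrightarrow> 0 \<le> g S"
  shows "0 \<le> play_cost w g alg t h"
proof (induction t arbitrary: h)
  case (Suc t)
  show ?case
  proof (cases "alg h")
    case (Compare S)
    then have S: "S \<subseteq> {1..n}"
      using assms(1) by (auto simp: admissible_def)
    then have "0 \<le> w x" if "x \<in> S" for x
      using assms(2)[of x] that by auto
    then show ?thesis
      using Compare assms(3)[OF S] Suc.IH
      by (auto intro!: add_nonneg_nonneg sum_nonneg mult_nonneg_nonneg divide_nonneg_nonneg)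
  qed simp
qed simp

text \<open>The cost is linear in \<open>g\<close>, and the play under \<open>w\<close> does not
  depend on \<open>j\<close>. So the sum over \<open>j\<close> can be bounded comparison by
  comparison, although no single \<open>g j\<close> need be small.\<close>

lemma weighted_play_cost_le:
  assumes "admissible n T alg" and "\<And>i. i \<in> {1..n} \<Longrightarrow> 0 < w i"
    and "\<And>S. S \<subseteq> {1..n} \<Longrightarrow> S \<noteq> {} \<Longrightarrow> (\<Sum>j\<in>J. q j * g j S) \<le> C" and "0 \<le> C"
  shows "(\<Sum>j\<in>J. q j * play_cost w (g j) alg t h) \<le> real t * C"
proof (induction t arbitrary: h)
  case (Suc t)
  show ?case
  proof (cases "alg h")
    case (Output X)
    then show ?thesis using assms(4) by simp
  next
    case (Compare S)
    note S = admissible_CompareD[OF assms(1) Compare]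
    have fin: "finite S" using S(1) finite_subset by blast
    have w: "0 < w x" if "x \<in> S" for x
      using assms(2)[of x] that S(1) by auto
    have pos: "0 < sum w S" using fin S(2) w by (intro sum_pos) auto
    define H where "H x = h @ [(S, x)]" for x
    have "(\<Sum>j\<in>J. q j * play_cost w (g j) alg (Suc t) h) =
        (\<Sum>j\<in>J. q j * g j S) + (\<Sum>j\<in>J. \<Sum>x\<in>S. w x / sum w S * (q j * play_cost w (g j) alg t (H x)))"
      by (simp add: Compare H_def distrib_left sum.distrib sum_distrib_left mult.left_commute)
    also have "(\<Sum>j\<in>J. \<Sum>x\<in>S. w x / sum w S * (q j * play_cost w (g j) alg t (H x))) =
        (\<Sum>x\<in>S. w x / sum w S * (\<Sum>j\<in>J. q j * play_cost w (g j) alg t (H x)))"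
      by (subst sum.swap) (simp add: sum_distrib_left)
    also have "\<dots> \<le> (\<Sum>x\<in>S. w x / sum w S * (real t * C))"
      using w pos Suc.IH by (intro sum_mono mult_left_mono) (auto simp: less_imp_le)
    also have "\<dots> = (\<Sum>x\<in>S. w x) / sum w S * (real t * C)"
      by (simp only: sum_divide_distrib sum_distrib_right)
    also have "\<dots> = real t * C" using pos by simp
    also have "(\<Sum>j\<in>J. q j * g j S) \<le> C" using S by (rule assms(3))
    finally show ?thesis by (simp add: algebra_simps)
  qed
qed simp

section \<open>Overlap of two choice laws that differ by an exchange\<close>

text \<open>The right side is one minus the total variation distance of the two observation laws.
  The loss is at most \<open>(w a - w b) / max W W'\<close>. The normalisers are crossed on purpose:
  \<open>b\<close> is charged under \<open>w\<close> and \<open>a\<close> under \<open>w'\<close>,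
  where each carries the lower score \<open>w b\<close>.\<close>

lemma sum_min_exchange_ge:
  fixes w w' :: "'a \<Rightarrow> real"
  assumes "finite S" "S \<noteq> {}" "a \<noteq> b"
    and "\<And>x. x \<in> S \<Longrightarrow> 0 < w x" "0 < w b" "w b \<le> w a"
    and "\<And>x. x \<noteq> a \<Longrightarrow> x \<noteq> b \<Longrightarrow> w' x = w x" "w' a = w b" "w' b = w a"
  shows "1 - w a * (indicator S b / sum w S) - w a * (indicator S a / sum w' S)
    \<le> (\<Sum>x\<in>S. min (w x / sum w S) (w' x / sum w' S))"
proof -
  define W where "W = sum w S"
  define W' where "W' = sum w' S"
  define d where "d = w a - w b"
  have d: "0 \<le> d" "d \<le> w a" using assms(5,6) by (simp_all add: d_def)
  have w': "0 < w' x" if "x \<in> S" for x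
    using assms(4)[OF that] assms(5-9) by (cases "x = a"; cases "x = b") auto
  have W: "0 < W" unfolding W_def using assms(1,2,4) by (intro sum_pos) auto
  have W': "0 < W'" unfolding W'_def using assms(1,2) w' by (intro sum_pos) auto
  have "W' = (\<Sum>x\<in>S. w x + d * indicator {b} x - d * indicator {a} x)"
    unfolding W'_def using assms(3,7-9) by (intro sum.cong) (auto simp: d_def indicator_def)
  also have "\<dots> = W + d * indicator S b - d * indicator S a"
    using assms(1) by (simp add: W_def sum.distrib sum_subtractf indicator_def flip: sum_distrib_left)
  finally have W'_eq: "W' = W + d * indicator S b - d * indicator S a" .
  have "(\<Sum>x\<in>S. min (w x) (w' x)) = (\<Sum>x\<in>S. w x - d * indicator {a} x)"
  proof (rule sum.cong)
    fix x
    show "min (w x) (w' x) = w x - d * indicator {a} x"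
      using assms(3,6-9) by (cases "x = a"; cases "x = b") (auto simp: d_def)
  qed simp
  also have "\<dots> = W - d * indicator S a"
    using assms(1) by (simp add: W_def sum_subtractf indicator_def flip: sum_distrib_left)
  finally have m: "(\<Sum>x\<in>S. min (w x) (w' x)) = W - d * indicator S a" .
  \<comment> \<open>Dividing by the larger normaliser bounds both fractions from below, so only the
    minima of the weights remain to be summed.\<close>
  have "(\<Sum>x\<in>S. min (w x) (w' x) / max W W') \<le> (\<Sum>x\<in>S. min (w x / W) (w' x / W'))"
  proof (rule sum_mono)
    fix x assume x: "x \<in> S"
    have "min (w x) (w' x) / max W W' \<le> w x / W"
      using W W' assms(4)[OF x] w'[OF x] by (intro frac_le) auto
    moreover have "min (w x) (w' x) / max W W' \<le> w' x / W'"
      using W W' assms(4)[OF x] w'[OF x] by (intro frac_le) auto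
    ultimately show "min (w x) (w' x) / max W W' \<le> min (w x / W) (w' x / W')" by simp
  qed
  then have "(W - d * indicator S a) / max W W' \<le> (\<Sum>x\<in>S. min (w x / W) (w' x / W'))"
    by (simp only: m flip: sum_divide_distrib)
  moreover have "1 - w a * (indicator S b / W) - w a * (indicator S a / W')
      \<le> (W - d * indicator S a) / max W W'"
  proof (cases "a \<in> S"; cases "b \<in> S")
    assume *: "a \<in> S" "b \<in> S"
    have "W' = W" using * W'_eq by simp
    moreover have "d / W \<le> w a / W" "0 \<le> w a / W" using W d by (auto intro: divide_right_mono)
    moreover have "(W - d) / W = 1 - d / W" using W by (simp add: diff_divide_distrib)
    ultimately show ?thesis using * by simp
  next
    assume *: "a \<in> S" "b \<notin> S"
    have W1: "W' = W - d" using * W'_eq by simp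
    \<comment> \<open>The sharper \<open>w a / W\<close> is given up here, since \<open>a\<close>
      carries the lower score only under \<open>w'\<close>.\<close>
    have "d / W \<le> w a / W'" using W' W1 d by (intro frac_le) auto
    moreover have "(W - d) / W = 1 - d / W" using W by (simp add: diff_divide_distrib)
    moreover have "max W W' = W" using W1 d by simp
    ultimately show ?thesis using * by simp
  next
    assume *: "a \<notin> S" "b \<in> S"
    have W1: "W' = W + d" using * W'_eq by simp
    have "d / W' \<le> w a / W" using W W1 d by (intro frac_le) auto
    moreover have "W / W' = 1 - d / W'" using W' W1 by (simp add: field_simps)
    moreover have "max W W' = W'" using W1 d by simp
    ultimately show ?thesis using * by simp
  next
    assume *: "a \<notin> S" "b \<notin> S"
    have "W' = W" using * W'_eq by simp
    then show ?thesis using * W by simp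
  qed
  ultimately show ?thesis unfolding W_def W'_def by linarith
qed

section \<open>Comparing two plays\<close>

lemma prob_play_Compare:
  assumes "alg h = Compare S" "finite S" "S \<noteq> {}" "\<And>x. x \<in> S \<Longrightarrow> 0 < w x"
  shows "measure_pmf.prob (play w alg (Suc t) h) E =
    (\<Sum>x\<in>S. w x / sum w S * measure_pmf.prob (play w alg t (h @ [(S, x)])) E)"
proof -
  note pmf = pmf_mnl_pmf[OF assms(2-4)]
  have "set_pmf (mnl_pmf w S) \<subseteq> S"
    by (auto simp: set_pmf_iff pmf split: if_splits)
  then show ?thesis
    using assms(1,2) by (simp add: prob_bind_pmf integral_measure_pmf_real[where A = S] pmf mult.commute subset_iff)
qed

text \<open>The inequality \<open>P E + P' E' \<le> 1 + TV(P, P')\<close> for disjoint events, proved along the coupling.\<close>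

lemma prob_play_exchange_le:
  assumes adm: "admissible n T alg" and "E \<inter> E' = {}" "a \<noteq> b"
    and w: "\<And>i. i \<in> {1..n} \<Longrightarrow> 0 < w i" and w': "\<And>i. i \<in> {1..n} \<Longrightarrow> 0 < w' i"
    and "0 < w b" "w b \<le> w a"
    and "\<And>x. x \<noteq> a \<Longrightarrow> x \<noteq> b \<Longrightarrow> w' x = w x" "w' a = w b" "w' b = w a"
  defines "g \<equiv> \<lambda>S. w a * (indicator S b / sum w S)"
    and "g' \<equiv> \<lambda>S. w a * (indicator S a / sum w' S)"
  shows "measure_pmf.prob (play w alg t h) E + measure_pmf.prob (play w' alg t h) E'
    \<le> 1 + play_cost w g alg t h + play_cost w' g' alg t h"
proof (induction t arbitrary: h)
  case 0
  \<comment> \<open>With no comparison left both plays output the same set, which lies in at most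
    one of the disjoint events. Stopping early is the same situation.\<close>
  show ?case using assms(2) by (auto simp: measure_return_pmf indicator_def)
next
  case (Suc t)
  show ?case
  proof (cases "alg h")
    case (Output X)
    then show ?thesis using assms(2) by (auto simp: measure_return_pmf indicator_def)
  next
    case (Compare S)
    note S = admissible_CompareD[OF adm Compare]
    have fin: "finite S" using S(1) finite_subset by blast
    have wS: "0 < w x" "0 < w' x" if "x \<in> S" for x
      using w[of x] w'[of x] that S(1) by auto
    have pos: "0 < sum w S" "0 < sum w' S" using fin S(2) wS by (auto intro!: sum_pos)
    have "0 \<le> g S" "0 \<le> g' S" if "S \<subseteq> {1..n}" for S
      using that w w' assms(6,7) unfolding g_def g'_def
      by (auto intro!: mult_nonneg_nonneg divide_nonneg_nonneg sum_nonneg simp: subset_iff less_imp_le)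
    then have cost_nonneg: "0 \<le> play_cost w g alg t h" "0 \<le> play_cost w' g' alg t h" for h
      by (auto intro!: play_cost_nonneg[OF adm w] play_cost_nonneg[OF adm w'])
    define p where "p x = w x / sum w S" for x
    define p' where "p' x = w' x / sum w' S" for x
    have p: "0 \<le> p x" "0 \<le> p' x" if "x \<in> S" for x
      using wS[OF that] pos by (auto simp: p_def p'_def)
    have p1: "sum p S = 1" "sum p' S = 1"
      using pos by (simp_all add: p_def p'_def flip: sum_divide_distrib)
    define f where "f x = measure_pmf.prob (play w alg t (h @ [(S, x)])) E" for x
    define f' where "f' x = measure_pmf.prob (play w' alg t (h @ [(S, x)])) E'" for x
    define C where "C x = play_cost w g alg t (h @ [(S, x)])" for x
    define C' where "C' x = play_cost w' g' alg t (h @ [(S, x)])" for x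
    have step: "p x * f x + p' x * f' x \<le> p x + p' x - min (p x) (p' x) + p x * C x + p' x * C' x"
      if x: "x \<in> S" for x
    proof -
      \<comment> \<open>\<open>m\<close> is the coupled mass, on which both plays observe
        \<open>x\<close> and continue from one common history; the induction hypothesis is used on
        this mass only.\<close>
      define m where "m = min (p x) (p' x)"
      have m: "0 \<le> m" "m \<le> p x" "m \<le> p' x" using p[OF x] by (auto simp: m_def)
      have "m * (f x + f' x) \<le> m * (1 + C x + C' x)"
        using m(1) Suc.IH by (intro mult_left_mono) (auto simp: f_def f'_def C_def C'_def)
      \<comment> \<open>Once the coupling is broken, each success probability is bounded by
        1.\<close>
      moreover have "(p x - m) * f x \<le> (p x - m) * 1" "(p' x - m) * f' x \<le> (p' x - m) * 1"
        using m by (auto intro!: mult_left_mono simp: f_def f'_def simp del: mult_1_right)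
      \<comment> \<open>The coupled mass lies below both laws, so each nonnegative cost may be
        charged to its own play in full.\<close>
      moreover have "m * C x \<le> p x * C x" "m * C' x \<le> p' x * C' x"
        using m cost_nonneg by (auto intro!: mult_right_mono simp: C_def C'_def)
      ultimately show ?thesis unfolding m_def[symmetric] by (simp add: algebra_simps)
    qed
    have "measure_pmf.prob (play w alg (Suc t) h) E = (\<Sum>x\<in>S. p x * f x)"
      unfolding p_def f_def by (rule prob_play_Compare[where alg = alg and h = h, OF Compare fin S(2)]) (rule wS)
    moreover have "measure_pmf.prob (play w' alg (Suc t) h) E' = (\<Sum>x\<in>S. p' x * f' x)"
      unfolding p'_def f'_def by (rule prob_play_Compare[where alg = alg and h = h, OF Compare fin S(2)]) (rule wS)
    ultimately have "measure_pmf.prob (play w alg (Suc t) h) E + measure_pmf.prob (play w' alg (Suc t) h) E'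
        = (\<Sum>x\<in>S. p x * f x + p' x * f' x)"
      by (simp only: sum.distrib)
    also have "\<dots> \<le> (\<Sum>x\<in>S. p x + p' x - min (p x) (p' x) + p x * C x + p' x * C' x)"
      by (intro sum_mono step)
    also have "\<dots> = 2 - (\<Sum>x\<in>S. min (p x) (p' x)) + (\<Sum>x\<in>S. p x * C x) + (\<Sum>x\<in>S. p' x * C' x)"
      using p1 by (simp add: sum.distrib sum_subtractf)
    also have "\<dots> \<le> 1 + (g S + (\<Sum>x\<in>S. p x * C x)) + (g' S + (\<Sum>x\<in>S. p' x * C' x))"
      using sum_min_exchange_ge[where w = w and w' = w', OF fin S(2) assms(3) wS(1) assms(6-10)]
      by (simp add: p_def p'_def g_def g'_def)
    also have "\<dots> = 1 + play_cost w g alg (Suc t) h + play_cost w' g' alg (Suc t) h"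
      by (simp add: Compare p_def p'_def C_def C'_def)
    finally show ?thesis .
  qed
qed

section \<open>Averaging over labellings and ranks\<close>

lemma sum_permutations_comp_transpose:
  assumes "i \<in> A" "j \<in> A"
  shows "(\<Sum>\<pi> | \<pi> permutes A. F (\<pi> \<circ> Transposition.transpose i j)) = (\<Sum>\<pi> | \<pi> permutes A. F \<pi>)"
  using permutes_compose[OF permutes_swap_id[OF assms]]
  by (intro sum.reindex_bij_witness[of _ "\<lambda>\<pi>. \<pi> \<circ> Transposition.transpose i j"
        "\<lambda>\<pi>. \<pi> \<circ> Transposition.transpose i j"])
    (simp_all add: comp_assoc)

lemma prob_trial_le:
  assumes adm: "admissible n T alg" and k: "1 \<le> k" "k < n"
    and pos: "\<And>i. i \<in> {1..n} \<Longrightarrow> 0 < \<theta> i"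
    and le: "\<And>j. k < j \<Longrightarrow> j \<le> n \<Longrightarrow> \<theta> j \<le> \<theta> k"
  shows "measure_pmf.prob (trial n \<theta> T alg) {(\<pi>, X). X = \<pi> ` {1..k}}
    \<le> 1 / 2 + real T / (\<Sum>i\<in>{k<..n}. \<theta> i / \<theta> k)"
proof -
  define P where "P = {\<pi>. \<pi> permutes {1..n}}"
  define N where "N = real (card P)"
  define w where "w \<pi> a = \<theta> (inv \<pi> a)" for \<pi> :: "nat \<Rightarrow> nat" and a
  define f where "f \<pi> = measure_pmf.prob (play (w \<pi>) alg T []) {\<pi> ` {1..k}}" for \<pi> :: "nat \<Rightarrow> nat"
  define g where "g \<pi> j S = \<theta> k * (indicator S (\<pi> j) / sum (w \<pi>) S)"
    for \<pi> :: "nat \<Rightarrow> nat" and j and S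
  define cost where "cost \<pi> j = play_cost (w \<pi>) (g \<pi> j) alg T []" for \<pi> :: "nat \<Rightarrow> nat" and j
  define W where "W = (\<Sum>j\<in>{k<..n}. \<theta> j)"
  have P: "finite P" "P \<noteq> {}"
    unfolding P_def using finite_permutations[of "{1..n}"] permutes_id[of "{1..n}"] by blast+
  have N: "0 < N" using P by (simp add: N_def card_gt_0_iff)
  have W: "0 < W" unfolding W_def using k pos by (intro sum_pos) auto
  have \<theta>k: "0 < \<theta> k" using k pos by simp
  have w_pos: "0 < w \<pi> i" if "\<pi> \<in> P" "i \<in> {1..n}" for \<pi> i
    using that permutes_in_image[OF permutes_inv[of \<pi> "{1..n}"]] pos by (auto simp: P_def w_def)
  have event: "Pair \<pi> -` {(\<pi>, X). X = \<pi> ` {1..k}} = {\<pi> ` {1..k}}" for \<pi> :: "nat \<Rightarrow> nat"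
    by auto
  have success: "measure_pmf.prob (trial n \<theta> T alg) {(\<pi>, X). X = \<pi> ` {1..k}} = sum f P / N"
    unfolding trial_def prob_bind_pmf P_def[symmetric] integral_pmf_of_set[OF P(2,1)] N_def
    by (simp add: f_def w_def[abs_def] event)
  have pair: "2 * sum f P \<le> N + 2 * (\<Sum>\<pi>\<in>P. cost \<pi> j)" if j: "j \<in> {k<..n}" for j
  proof -
    define \<tau> where "\<tau> = Transposition.transpose k j"
    have reindex: "(\<Sum>\<pi>\<in>P. F (\<pi> \<circ> \<tau>)) = sum F P" for F :: "_ \<Rightarrow> real"
      unfolding P_def \<tau>_def using j k by (intro sum_permutations_comp_transpose) auto
    have "f \<pi> + f (\<pi> \<circ> \<tau>) \<le> 1 + cost \<pi> j + cost (\<pi> \<circ> \<tau>) j" if \<pi>: "\<pi> \<in> P" for \<pi>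
    proof -
      have perm: "\<pi> permutes {1..n}" using \<pi> by (simp add: P_def)
      have \<tau>: "\<tau> permutes {1..n}"
        unfolding \<tau>_def using j k by (intro permutes_swap_id) auto
      have \<pi>': "\<pi> \<circ> \<tau> \<in> P"
        using permutes_compose[OF \<tau> perm] by (simp add: P_def)
      have inj: "inj \<pi>" using perm by (rule permutes_inj)
      have w_image: "w \<pi> (\<pi> i) = \<theta> i" for i
        by (simp add: w_def inv_f_f[OF inj])
      have w_comp: "w (\<pi> \<circ> \<tau>) x = \<theta> (\<tau> (inv \<pi> x))" for x
        using permutes_bij[OF perm] permutes_bij[OF \<tau>]
        by (simp add: w_def o_inv_distrib \<tau>_def)
      have w_swap: "w (\<pi> \<circ> \<tau>) (\<pi> k) = \<theta> j" "w (\<pi> \<circ> \<tau>) (\<pi> j) = \<theta> k"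
        unfolding w_comp inv_f_f[OF inj] by (simp_all add: \<tau>_def)
      have w_other: "w (\<pi> \<circ> \<tau>) x = w \<pi> x" if "x \<noteq> \<pi> k" "x \<noteq> \<pi> j" for x
      proof -
        have "\<pi> (inv \<pi> x) = x"
          using permutes_surj[OF perm] by (simp add: surj_f_inv_f)
        then have "inv \<pi> x \<noteq> k" "inv \<pi> x \<noteq> j" using that by metis+
        then show ?thesis unfolding w_comp by (simp add: w_def \<tau>_def)
      qed
      \<comment> \<open>The label \<open>\<pi> j\<close> separates the two correct answers: the
        exchange gives it rank \<open>k\<close>.\<close>
      have "\<pi> j \<in> (\<pi> \<circ> \<tau>) ` {1..k}"
        using k by (auto simp: \<tau>_def image_iff intro!: bexI[of _ k])
      moreover have "\<pi> j \<notin> \<pi> ` {1..k}"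
        using j by (simp add: inj_image_mem_iff[OF inj])
      ultimately have disj: "{\<pi> ` {1..k}} \<inter> {(\<pi> \<circ> \<tau>) ` {1..k}} = {}" by blast
      have "\<pi> k \<noteq> \<pi> j" using j by (simp add: inj_eq[OF inj])
      have "0 < \<theta> j" "\<theta> j \<le> \<theta> k" using pos[of j] le[of j] j by auto
      then have "f \<pi> + f (\<pi> \<circ> \<tau>) \<le>
          1 + play_cost (w \<pi>) (\<lambda>S. w \<pi> (\<pi> k) * (indicator S (\<pi> j) / sum (w \<pi>) S)) alg T []
          + play_cost (w (\<pi> \<circ> \<tau>))
            (\<lambda>S. w \<pi> (\<pi> k) * (indicator S (\<pi> k) / sum (w (\<pi> \<circ> \<tau>)) S)) alg T []"
        unfolding f_def
        by (intro prob_play_exchange_le[OF adm disj \<open>\<pi> k \<noteq> \<pi> j\<close> w_pos[OF \<pi>] w_pos[OF \<pi>'] _ _ w_other])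
          (simp_all add: w_image w_swap)
      \<comment> \<open>After the exchange \<open>\<pi> k\<close> has rank \<open>j\<close>, so the
        second charge is the same \<open>cost\<close>, taken at
        \<open>\<pi> \<circ> \<tau>\<close>.\<close>
      moreover have "(\<pi> \<circ> \<tau>) j = \<pi> k" by (simp add: \<tau>_def)
      ultimately show ?thesis by (simp only: w_image cost_def g_def[abs_def])
    qed
    then have "(\<Sum>\<pi>\<in>P. f \<pi> + f (\<pi> \<circ> \<tau>)) \<le> (\<Sum>\<pi>\<in>P. 1 + cost \<pi> j + cost (\<pi> \<circ> \<tau>) j)"
      by (rule sum_mono)
    then show ?thesis
      using reindex[of f] reindex[of "\<lambda>\<pi>. cost \<pi> j"] by (simp add: sum.distrib N_def)
  qed
  have cost: "(\<Sum>j\<in>{k<..n}. \<theta> j * cost \<pi> j) \<le> real T * \<theta> k" if \<pi>: "\<pi> \<in> P" for \<pi>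
    unfolding cost_def
  proof (rule weighted_play_cost_le[OF adm w_pos[OF \<pi>]])
    fix S :: "nat set" assume S: "S \<subseteq> {1..n}" "S \<noteq> {}"
    have perm: "\<pi> permutes {1..n}" using \<pi> by (simp add: P_def)
    have inj: "inj \<pi>" using perm by (rule permutes_inj)
    have fin: "finite S" using S(1) finite_subset by blast
    have wS: "0 < w \<pi> x" if "x \<in> S" for x using that S w_pos[OF \<pi>] by blast
    have wS_pos: "0 < sum (w \<pi>) S" using fin S wS by (intro sum_pos) auto
    \<comment> \<open>The factor \<open>\<theta> j\<close> turns the indicators into the weight of
      those labels in \<open>S\<close> that have rank above \<open>k\<close>, which is part of the
      normaliser.\<close>
    have "(\<Sum>j\<in>{k<..n}. \<theta> j * indicator S (\<pi> j)) = (\<Sum>j\<in>{j\<in>{k<..n}. \<pi> j \<in> S}. w \<pi> (\<pi> j))"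
      by (rule sum.mono_neutral_cong_right) (auto simp: w_def inv_f_f[OF inj])
    also have "\<dots> = sum (w \<pi>) (\<pi> ` {j\<in>{k<..n}. \<pi> j \<in> S})"
      using inj by (subst sum.reindex) (auto intro: inj_on_subset)
    also have "\<dots> \<le> sum (w \<pi>) S"
      using fin wS by (intro sum_mono2) (auto simp: less_imp_le)
    finally have "\<theta> k * ((\<Sum>j\<in>{k<..n}. \<theta> j * indicator S (\<pi> j)) / sum (w \<pi>) S) \<le> \<theta> k * 1"
      using \<theta>k wS_pos by (intro mult_left_mono) auto
    moreover have "(\<Sum>j\<in>{k<..n}. \<theta> j * g \<pi> j S) =
        \<theta> k * ((\<Sum>j\<in>{k<..n}. \<theta> j * indicator S (\<pi> j)) / sum (w \<pi>) S)"
      unfolding g_def sum_divide_distrib sum_distrib_left by (intro sum.cong) (simp_all add: ac_simps)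
    ultimately show "(\<Sum>j\<in>{k<..n}. \<theta> j * g \<pi> j S) \<le> \<theta> k" by simp
  qed (use \<theta>k in simp_all)
  \<comment> \<open>The bounds for the single ranks \<open>j\<close> are averaged with unnormalised
    weights \<open>\<theta> j\<close> of total \<open>W\<close>; the division by \<open>W\<close>
    and \<open>N\<close> comes last.\<close>
  have "W * (2 * sum f P) = (\<Sum>j\<in>{k<..n}. \<theta> j * (2 * sum f P))"
    by (simp add: W_def sum_distrib_right)
  also have "\<dots> \<le> (\<Sum>j\<in>{k<..n}. \<theta> j * (N + 2 * (\<Sum>\<pi>\<in>P. cost \<pi> j)))"
    using pair pos by (intro sum_mono mult_left_mono) (auto simp: less_imp_le)
  also have "\<dots> = W * N + 2 * (\<Sum>j\<in>{k<..n}. \<Sum>\<pi>\<in>P. \<theta> j * cost \<pi> j)"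
    by (simp add: W_def distrib_left sum.distrib sum_distrib_left sum_distrib_right mult.left_commute)
  also have "(\<Sum>j\<in>{k<..n}. \<Sum>\<pi>\<in>P. \<theta> j * cost \<pi> j) = (\<Sum>\<pi>\<in>P. \<Sum>j\<in>{k<..n}. \<theta> j * cost \<pi> j)"
    by (rule sum.swap)
  also have "\<dots> \<le> (\<Sum>\<pi>\<in>P. real T * \<theta> k)"
    by (intro sum_mono cost)
  also have "\<dots> = N * (real T * \<theta> k)" by (simp add: N_def)
  finally have "sum f P / N \<le> 1 / 2 + real T * \<theta> k / W"
    using W N by (simp add: field_simps)
  also have "real T * \<theta> k / W = real T / (\<Sum>i\<in>{k<..n}. \<theta> i / \<theta> k)"
    by (simp add: W_def flip: sum_divide_distrib)
  finally show ?thesis by (simp only: success)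
qed

section \<open>Averaging over the seed\<close>

theorem theorem6:
  fixes n k T :: nat and \<theta> :: "nat \<Rightarrow> real" and c :: real
    and M :: "'r measure" and A :: "'r \<Rightarrow> history \<Rightarrow> action"
  assumes "1 \<le> k" and "k < n"
    and "\<And>i. i \<in> {1..n} \<Longrightarrow> 0 < \<theta> i"
    and "\<And>i j. 1 \<le> i \<Longrightarrow> i \<le> j \<Longrightarrow> j \<le> n \<Longrightarrow> \<theta> j \<le> \<theta> i"
    and "\<theta> (k + 1) < \<theta> k"
    and "c < 1 / 18"
    and "randomized_algorithm n T M A"
    and "real T \<le> c * (\<Sum>i\<in>{k<..n}. \<theta> i / \<theta> k)"
  shows "success_prob n k \<theta> T M A \<le> 7 / 8"
proof -
  interpret prob_space M
    using assms(7) by (simp add: randomized_algorithm_def)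
  let ?p = "\<lambda>r. measure_pmf.prob (trial n \<theta> T (A r)) {(\<pi>, X). X = \<pi> ` {1..k}}"
  have "0 < (\<Sum>i\<in>{k<..n}. \<theta> i / \<theta> k)"
    using assms(1-3) by (intro sum_pos) auto
  then have "real T / (\<Sum>i\<in>{k<..n}. \<theta> i / \<theta> k) \<le> c"
    using assms(8) by (simp add: pos_divide_le_eq)
  moreover have "?p r \<le> 1 / 2 + real T / (\<Sum>i\<in>{k<..n}. \<theta> i / \<theta> k)" if "r \<in> space M" for r
  proof (rule prob_trial_le)
    show "admissible n T (A r)"
      using assms(7) that by (simp add: randomized_algorithm_def)
  qed (use assms(1-4) in auto)
  \<comment> \<open>Each seed gives at most \<open>1 / 2 + c < 1 / 2 + 1 / 18 = 5 / 9\<close>, which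
    is below \<open>7 / 8\<close>.\<close>
  ultimately have bound: "?p r \<le> 7 / 8" if "r \<in> space M" for r
    using assms(6) that by fastforce
  have "integrable M ?p"
    by (rule integrable_const_bound[where B = 1]) (auto intro: measurable_trial[OF assms(7)])
  then show ?thesis
    unfolding success_prob_def using bound by (intro integral_le_const) auto
qed

end
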